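(* Let $f, g : \mathbb{R}^n \to \mathbb{R}^n$, $C \in \mathbb{R}^{p\times n}$, $x_0, \tilde{x}_0 \in \mathbb{R}^n$, and $\Delta = g - f$. Let $\mathbf{x}(t,s)$, $\mathbf{y}(t,s)$ be the state and output of the auxiliary system defined in the context, let $M(\mathbf{x}) \in \mathbb{R}^{p\times p}$ be a symmetric positive definite matrix (possibly depending on $\mathbf{x}$), and let $M_C = C^\top M C$. Assume that the auxiliary system is contracting with respect to $M_C$ with rate $\mu \in \mathbb{R}_{>0}$, i.e., for all $s\in[0,1]$ and all $\mathbf{x} \in \mathbb{R}^n$, $$\Big(\tfrac{\partial f}{\partial \mathbf{x}} + s\tfrac{\partial \Delta}{\partial \mathbf{x}}\Big)^\top M_C + \dot{M}_C + M_C \Big(\tfrac{\partial f}{\partial \mathbf{x}} + s\tfrac{\partial \Delta}{\partial \mathbf{x}}\Big) \preceq -2\mu M_C.$$ If $C\Delta(\mathbf{x}) = 0$ for all $\mathbf{x}\in\mathbb{R}^n$, then the measurements of the two systems $\dot{x} = f(x)$, $x(0)=x_0$, $y = Cx$ and $\dot{\tilde{x}} = g(\tilde{x})$, $\tilde{x}(0) = \tilde{x}_0$, $\tilde{y} = C\tilde{x}$ contract to each other with rate $\mu$, in the sense that the length $$L(t) = \int_0^1 \|\partial_s \mathbf{y}(t,s)\|_M \, ds$$ between their output trajectories satisfies $L(t) \leq e^{-\mu t} L(0)$ for all $t \geq 0$.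
   Context: The auxiliary system, parametrized by $s \in [0,1]$, is $$\dot{\mathbf{x}} = f(\mathbf{x}) + s\Delta(\mathbf{x}), \quad \mathbf{x}(0) = (1-s)x_0 + s\tilde{x}_0, \quad \mathbf{y} = C\mathbf{x}, \quad \Delta(\mathbf{x}) = g(\mathbf{x}) - f(\mathbf{x}).$$ Its solution is written $\mathbf{x}(t,s)$ and its output $\mathbf{y}(t,s) = C\mathbf{x}(t,s)$. For $s=0$ it gives the system $\dot{x}=f(x)$, $x(0) = x_0$, $y=Cx$; for $s=1$ it gives $\dot{\tilde{x}} = g(\tilde{x})$, $\tilde{x}(0)=\tilde{x}_0$, $\tilde{y}=C\tilde{x}$. The norm is $\|v\|_M = \sqrt{v^\top M v}$; in $L(t)$ the matrix $M$ is evaluated at $\mathbf{x}(t,s)$. A dot denotes the time derivative along solutions of the auxiliary system, so $\dot{M}_C = C^\top \dot{M} C$ with $\dot{M}$ the derivative of $M(\mathbf{x})$ along the vector field $f + s\Delta$. For symmetric matrices, $X\preceq Y$ means that $Y-X$ is positive semidefinite. Standing regularity: $f$, $g$ and $M$ are continuously differentiable, and solutions of the auxiliary system exist for all $t \geq 0$ and all $s\in[0,1]$. *)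

theory Defs
  imports "HOL-Analysis.Analysis"
begin

definition continuously_differentiable ::
    "('a::real_normed_vector \<Rightarrow> 'b::real_normed_vector) \<Rightarrow> bool" where
  "continuously_differentiable F \<longleftrightarrow>
     (\<exists>F' :: 'a \<Rightarrow> 'a \<Rightarrow>\<^sub>L 'b.
        (\<forall>x. (F has_derivative blinfun_apply (F' x)) (at x)) \<and> continuous_on UNIV F')"

definition pos_semidef :: "real ^ 'n ^ 'n \<Rightarrow> bool" where
  "pos_semidef A \<longleftrightarrow> transpose A = A \<and> (\<forall>v. 0 \<le> v \<bullet> (A *v v))"

definition pos_def :: "real ^ 'n ^ 'n \<Rightarrow> bool" where
  "pos_def A \<longleftrightarrow> transpose A = A \<and> (\<forall>v. v \<noteq> 0 \<longrightarrow> 0 < v \<bullet> (A *v v))"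

definition loewner_le :: "real ^ 'n ^ 'n \<Rightarrow> real ^ 'n ^ 'n \<Rightarrow> bool"
    (infix \<open>\<preceq>\<^sub>L\<close> 50) where
  "X \<preceq>\<^sub>L Y \<longleftrightarrow> pos_semidef (Y - X)"

definition weighted_norm :: "real ^ 'n ^ 'n \<Rightarrow> real ^ 'n \<Rightarrow> real" where
  "weighted_norm M v = sqrt (v \<bullet> (M *v v))"

definition derivative_along ::
    "('a::real_normed_vector \<Rightarrow> 'b::real_normed_vector) \<Rightarrow> ('a \<Rightarrow> 'a) \<Rightarrow> 'a \<Rightarrow> 'b" where
  "derivative_along M F x = frechet_derivative M (at x) (F x)"

definition aux_field ::
    "('a::real_normed_vector \<Rightarrow> 'a) \<Rightarrow> ('a \<Rightarrow> 'a) \<Rightarrow> real \<Rightarrow> 'a \<Rightarrow> 'a" where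
  "aux_field f \<Delta> s x = f x + s *\<^sub>R \<Delta> x"

text \<open>Arguments of a solution are time and parameter, in this order. Nothing is required for
  negative times or for parameters outside the unit interval, so the derivative at time 0 is
  one-sided.\<close>

definition aux_solution ::
    "('a::real_normed_vector \<Rightarrow> 'a) \<Rightarrow> ('a \<Rightarrow> 'a) \<Rightarrow> 'a \<Rightarrow> 'a \<Rightarrow> (real \<Rightarrow> real \<Rightarrow> 'a) \<Rightarrow> bool" where
  "aux_solution f \<Delta> x0 x0' x \<longleftrightarrow>
     (\<forall>s\<in>{0..1}.
        x 0 s = (1 - s) *\<^sub>R x0 + s *\<^sub>R x0' \<and>
        (\<forall>t\<ge>0. ((\<lambda>\<tau>. x \<tau> s) has_vector_derivative aux_field f \<Delta> s (x t s)) (at t within {0..})))"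

text \<open>\<open>W\<close> is the weight as a function of the state \<open>x\<close>, not of the output \<open>y\<close>.\<close>

definition output_length ::
    "('a \<Rightarrow> real ^ 'p ^ 'p) \<Rightarrow> (real \<Rightarrow> real \<Rightarrow> 'a) \<Rightarrow> (real \<Rightarrow> real \<Rightarrow> real ^ 'p) \<Rightarrow> real \<Rightarrow> real" where
  "output_length W x y t =
     integral {0..1}
       (\<lambda>s. weighted_norm (W (x t s)) (vector_derivative (\<lambda>\<sigma>. y t \<sigma>) (at s within {0..1})))"

end

theory Submission
  imports Defs
begin

text \<open>The state is differentiable in the parameter \<open>s\<close>, and \<open>w = \<partial>\<^sub>s x\<close> satisfies
  \<open>w' = J w + \<Delta>(x)\<close>, where \<open>J\<close> is the Jacobian of the field \<open>f + s \<Delta>\<close>. The inhomogeneity is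
  invisible at the output because \<open>C \<Delta> = 0\<close>, so the contraction inequality tested on \<open>w\<close> says that
  the square of the weighted norm of \<open>\<partial>\<^sub>s y = C w\<close> has derivative at most \<open>- 2 \<mu>\<close> times itself.
  Gronwall's inequality gives the decay for every \<open>s\<close>, and one integrates over \<open>s\<close>.\<close>

section \<open>Gronwall inequalities and uniform linearization\<close>

text \<open>Multiplying by the integrating factor \<open>exp (- k * t)\<close> turns the error term
  into the constant \<open>c\<close>, so \<open>u t * exp (- k * t) - c * t\<close> has nonpositive
  derivative and the mean value theorem finishes without any integral. A positive \<open>k\<close>
  serves the error estimates, \<open>k = - 2 * \<mu>\<close> the final decay.\<close>

lemma gronwall:
  fixes u u' :: "real \<Rightarrow> real"
  assumes u: "\<And>t. t \<in> {0..T} \<Longrightarrow> (u has_real_derivative u' t) (at t within {0..T})"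
    and le: "\<And>t. t \<in> {0..T} \<Longrightarrow> u' t \<le> k * u t + c * exp (k * t)"
    and t: "t \<in> {0..T}"
  shows "u t \<le> (u 0 + c * t) * exp (k * t)"
proof -
  define w where "w = (\<lambda>t. u t * exp (- k * t) - c * t)"
  have w: "(w has_real_derivative (u' r - k * u r) * exp (- k * r) - c) (at r within {0..t})"
    if "r \<in> {0..t}" for r
  proof -
    have "(u has_real_derivative u' r) (at r within {0..t})"
      by (rule DERIV_subset[OF u]) (use that t in auto)
    then show ?thesis
      unfolding w_def by (auto intro!: derivative_eq_intros simp: algebra_simps)
  qed
  obtain r where r: "r \<in> {0..t}" "w t - w 0 = ((u' r - k * u r) * exp (- k * r) - c) * (t - 0)"
    using mvt_very_simple[of 0 t w "\<lambda>r. (*) ((u' r - k * u r) * exp (- k * r) - c)"] w t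
    by (auto simp: has_field_derivative_def)
  have "(u' r - k * u r) * exp (- k * r) \<le> (c * exp (k * r)) * exp (- k * r)"
    using le[of r] r t by (intro mult_right_mono) auto
  also have "\<dots> = c"
    by (simp flip: exp_add)
  finally have "w t \<le> w 0"
    using r t by (smt (verit) atLeastAtMost_iff mult_nonneg_nonneg mult_minus_left)
  then have "u t * exp (- k * t) * exp (k * t) \<le> (u 0 + c * t) * exp (k * t)"
    unfolding w_def by (intro mult_right_mono) auto
  then show ?thesis
    by (simp add: mult.assoc flip: exp_add)
qed

text \<open>The squared norm is used because it is differentiable even where \<open>p\<close>
  vanishes. Its derivative contains \<open>2 * (norm (p r) * \<epsilon>)\<close>, which is split by
  the inequality between the means; this is the source of the \<open>1\<close> in the exponent and
  of \<open>\<epsilon>\<^sup>2\<close>.\<close>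

lemma gronwall_norm:
  fixes p p' :: "real \<Rightarrow> 'a::real_inner"
  assumes p: "\<And>t. t \<in> {0..T} \<Longrightarrow> (p has_vector_derivative p' t) (at t within {0..T})"
    and le: "\<And>t. t \<in> {0..T} \<Longrightarrow> norm (p' t) \<le> L * norm (p t) + \<epsilon>"
    and "L \<ge> 0" and t: "t \<in> {0..T}"
  shows "(norm (p t))\<^sup>2 \<le> ((norm (p 0))\<^sup>2 + \<epsilon>\<^sup>2 * t) * exp ((2 * L + 1) * t)"
proof -
  have "p t \<bullet> p t \<le> (p 0 \<bullet> p 0 + \<epsilon>\<^sup>2 * t) * exp ((2 * L + 1) * t)"
  proof (rule gronwall[OF _ _ t])
    fix r assume r: "r \<in> {0..T}"
    have "(p has_derivative (\<lambda>h. h *\<^sub>R p' r)) (at r within {0..T})"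
      using p[OF r] by (simp add: has_vector_derivative_def)
    from has_derivative_inner[OF this this]
    show "((\<lambda>t. p t \<bullet> p t) has_real_derivative 2 * (p r \<bullet> p' r)) (at r within {0..T})"
      unfolding has_field_derivative_def
      by (rule has_derivative_eq_rhs) (auto simp: inner_commute)
    have "p r \<bullet> p' r \<le> norm (p r) * (L * norm (p r) + \<epsilon>)"
      using norm_cauchy_schwarz[of "p r" "p' r"] le[OF r]
      by (smt (verit) mult_left_mono norm_ge_zero)
    moreover have "2 * (norm (p r) * \<epsilon>) \<le> (norm (p r))\<^sup>2 + \<epsilon>\<^sup>2"
      using sum_squares_bound[of "norm (p r)" \<epsilon>] by simp
    ultimately have "2 * (p r \<bullet> p' r) \<le> (2 * L + 1) * (norm (p r))\<^sup>2 + \<epsilon>\<^sup>2"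
      by (simp add: algebra_simps power2_eq_square)
    \<comment> \<open>The constant error is enlarged to the exponential shape that
      \<open>gronwall\<close> expects; the exponent is nonnegative here.\<close>
    moreover have "\<epsilon>\<^sup>2 * 1 \<le> \<epsilon>\<^sup>2 * exp ((2 * L + 1) * r)"
      using r \<open>L \<ge> 0\<close> by (intro mult_left_mono) auto
    ultimately show "2 * (p r \<bullet> p' r) \<le> (2 * L + 1) * (p r \<bullet> p r) + \<epsilon>\<^sup>2 * exp ((2 * L + 1) * r)"
      by (simp add: power2_norm_eq_inner)
  qed
  then show ?thesis
    by (simp add: power2_norm_eq_inner)
qed

text \<open>By the mean value inequality the remainder is controlled by the oscillation of
  \<open>H'\<close> near \<open>a\<close>, and uniform continuity of \<open>H'\<close> on a compact
  ball around \<open>K\<close> makes one radius serve all \<open>a\<close>. The point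
  \<open>b\<close> may leave \<open>K\<close>, as neighbouring trajectories do.\<close>

lemma uniform_linearization_on_compact:
  fixes H :: "'a::euclidean_space \<Rightarrow> 'b::real_normed_vector"
  assumes H: "\<And>z. (H has_derivative blinfun_apply (H' z)) (at z)"
    and H': "continuous_on UNIV H'"
    and K: "compact K" and "\<epsilon> > 0"
  obtains \<delta> where "\<delta> > 0"
    "\<And>a b. a \<in> K \<Longrightarrow> norm (b - a) < \<delta> \<Longrightarrow> norm (H b - H a - H' a (b - a)) \<le> \<epsilon> * norm (b - a)"
proof -
  obtain R where R: "\<And>a. a \<in> K \<Longrightarrow> norm a \<le> R"
    using compact_imp_bounded[OF K] unfolding bounded_iff by blast
  \<comment> \<open>The margin 1, with the cap \<open>min d 1\<close> on the radius below, keeps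
    every ball around a point of \<open>K\<close> inside this compact ball.\<close>
  have "uniformly_continuous_on (cball 0 (R + 1)) H'"
    by (rule compact_uniformly_continuous) (auto intro: continuous_on_subset[OF H'])
  from this[unfolded uniformly_continuous_on_def, rule_format, OF \<open>\<epsilon> > 0\<close>]
  obtain d where d: "d > 0" "\<And>a b. a \<in> cball 0 (R + 1) \<Longrightarrow> b \<in> cball 0 (R + 1) \<Longrightarrow>
      dist b a < d \<Longrightarrow> dist (H' b) (H' a) < \<epsilon>"
    by blast
  show thesis
  proof
    show "min d 1 > 0" using d by simp
    fix a b assume a: "a \<in> K" and b: "norm (b - a) < min d 1"
    have "norm (H b - H a - H' a (b - a)) \<le> norm (b - a) * \<epsilon>"
    proof (rule differentiable_bound_linearization[where S = "ball a (min d 1)"])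
      show "a + t *\<^sub>R (b - a) \<in> ball a (min d 1)" if "t \<in> {0..1}" for t
      proof -
        have "\<bar>t\<bar> * norm (b - a) \<le> 1 * norm (b - a)"
          using that by (intro mult_right_mono) auto
        then show ?thesis
          using b by (simp add: dist_norm)
      qed
      show "(H has_derivative blinfun_apply (H' z)) (at z within ball a (min d 1))" for z
        by (rule has_derivative_at_withinI[OF H])
      show "a \<in> ball a (min d 1)" using d by simp
      fix z assume z: "z \<in> ball a (min d 1)"
      have "norm a \<le> R" using a R by simp
      moreover have "norm z \<le> norm a + dist a z"
        by (metis dist_commute dist_norm norm_triangle_sub)
      ultimately have "dist (H' z) (H' a) < \<epsilon>"
        using z by (intro d) (auto simp: dist_commute)
      then show "onorm (blinfun_apply (H' z) - blinfun_apply (H' a)) \<le> \<epsilon>"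
        by (simp add: dist_norm norm_blinfun.rep_eq minus_blinfun.rep_eq fun_diff_def)
    qed
    then show "norm (H b - H a - H' a (b - a)) \<le> \<epsilon> * norm (b - a)"
      by (simp add: mult.commute)
  qed
qed

text \<open>The Lipschitz bound is only available in a tube of radius \<open>\<delta>\<close>; the bound on the initial
  distance excludes a first exit from the tube.\<close>

lemma gronwall_tube:
  fixes p p' :: "real \<Rightarrow> 'a::real_inner"
  assumes p: "\<And>t. t \<in> {0..T} \<Longrightarrow> (p has_vector_derivative p' t) (at t within {0..T})"
    and le: "\<And>t. t \<in> {0..T} \<Longrightarrow> norm (p t) < \<delta> \<Longrightarrow> norm (p' t) \<le> L * norm (p t)"
    and L: "L \<ge> 0" and small: "norm (p 0) * exp ((L + 1) * T) < \<delta>"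
    and t: "t \<in> {0..T}"
  shows "norm (p t) \<le> norm (p 0) * exp ((L + 1) * T)"
proof -
  have cont: "continuous_on {0..T} p"
    using has_vector_derivative_continuous[OF p] by (simp add: continuous_on_eq_continuous_within)
  \<comment> \<open>Being in the tube strictly before \<open>r\<close> suffices for the bound at
    \<open>r\<close> itself, so this also applies at a first exit time.\<close>
  have bound: "norm (p r) \<le> norm (p 0) * exp ((L + 1) * T)"
    if r: "r \<in> {0..T}" and inside: "\<And>\<tau>. \<tau> \<in> {0..<r} \<Longrightarrow> norm (p \<tau>) < \<delta>" for r
  proof -
    have *: "norm (p \<tau>) \<le> norm (p 0) * exp ((L + 1) * T)" if \<tau>: "\<tau> \<in> {0..<r}" for \<tau>
    proof -
      \<comment> \<open>No error term, so \<open>\<epsilon> = 0\<close>. The exponent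
        \<open>2 * L + 1\<close> is then rounded up to \<open>2 * (L + 1)\<close> to make the
        right-hand side a square.\<close>
      have "(norm (p \<tau>))\<^sup>2 \<le> ((norm (p 0))\<^sup>2 + 0\<^sup>2 * \<tau>) * exp ((2 * L + 1) * \<tau>)"
      proof (rule gronwall_norm[where p' = p' and T = \<tau>])
        show "(p has_vector_derivative p' \<rho>) (at \<rho> within {0..\<tau>})" if "\<rho> \<in> {0..\<tau>}" for \<rho>
          by (rule has_vector_derivative_within_subset[OF p]) (use that \<tau> r in auto)
      qed (use le inside \<tau> r L in auto)
      also have "\<dots> \<le> (norm (p 0))\<^sup>2 * exp (2 * ((L + 1) * T))"
      proof -
        have "L * \<tau> \<le> L * T" using \<tau> r L by (intro mult_left_mono) auto
        then have "(2 * L + 1) * \<tau> \<le> 2 * ((L + 1) * T)"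
          using \<tau> r by (simp add: algebra_simps)
        then show ?thesis by (simp add: mult_left_mono)
      qed
      also have "\<dots> = (norm (p 0) * exp ((L + 1) * T))\<^sup>2"
        by (simp add: power_mult_distrib exp_double)
      finally show ?thesis
        by (rule power2_le_imp_le) simp
    qed
    show ?thesis
    \<comment> \<open>For \<open>r = 0\<close> the interval \<open>{0..<r}\<close> is empty and has
      no closure point; otherwise the bound passes to \<open>r\<close> by continuity.\<close>
    proof (cases "r = 0")
      case True
      have "norm (p 0) * 1 \<le> norm (p 0) * exp ((L + 1) * T)"
        using r L by (intro mult_left_mono) auto
      with True show ?thesis by simp
    next
      case False
      then have "r > 0" using r by simp
      have "continuous_on (closure {0..<r}) (\<lambda>\<tau>. norm (p \<tau>))"
        using \<open>r > 0\<close> r by (auto intro!: continuous_on_norm continuous_on_subset[OF cont])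
      from continuous_le_on_closure[OF this] * \<open>r > 0\<close> show ?thesis by auto
    qed
  qed
  have inside: "norm (p r) < \<delta>" if r: "r \<in> {0..T}" for r
  proof (rule ccontr)
    \<comment> \<open>The times outside the tube form a compact set. At its least element
      \<open>r0\<close> the estimate \<open>bound\<close> applies and contradicts
      \<open>small\<close>.\<close>
    define X where "X = {\<tau> \<in> {0..T}. \<delta> \<le> norm (p \<tau>)}"
    assume "\<not> norm (p r) < \<delta>"
    then have "X \<noteq> {}" using r by (auto simp: X_def)
    have "closed X" unfolding X_def
      by (intro continuous_closed_preimage_constant continuous_on_closed_Collect_le
          continuous_intros cont closed_atLeastAtMost)
    moreover have "bounded X"
      by (rule bounded_subset[of "{0..T}"]) (auto simp: X_def)
    ultimately obtain r0 where r0: "r0 \<in> X" "\<And>\<tau>. \<tau> \<in> X \<Longrightarrow> r0 \<le> \<tau>"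
      using compact_attains_inf[of X] \<open>X \<noteq> {}\<close> compact_eq_bounded_closed by blast
    have "norm (p r0) \<le> norm (p 0) * exp ((L + 1) * T)"
      using r0 by (intro bound) (force simp: X_def not_le)+
    then show False using r0 small by (simp add: X_def)
  qed
  then show ?thesis
    using t by (intro bound) auto
qed

section \<open>Differentiability of solutions in a parameter\<close>

lemma has_vector_derivative_iff_tendsto:
  "(f has_vector_derivative v) (at s within S) \<longleftrightarrow>
     ((\<lambda>\<sigma>. (f \<sigma> - f s) /\<^sub>R (\<sigma> - s)) \<longlongrightarrow> v) (at s within S)"
proof -
  have "norm ((f \<sigma> - f s - (\<sigma> - s) *\<^sub>R v) /\<^sub>R norm (\<sigma> - s)) = norm ((f \<sigma> - f s) /\<^sub>R (\<sigma> - s) - v)"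
    if "\<sigma> \<noteq> s" for \<sigma>
  proof -
    have "(f \<sigma> - f s) /\<^sub>R (\<sigma> - s) - v = (f \<sigma> - f s - (\<sigma> - s) *\<^sub>R v) /\<^sub>R (\<sigma> - s)"
      using that by (simp add: scaleR_diff_right)
    then show ?thesis by simp
  qed
  then have "((\<lambda>\<sigma>. norm ((f \<sigma> - f s - (\<sigma> - s) *\<^sub>R v) /\<^sub>R norm (\<sigma> - s))) \<longlongrightarrow> 0) (at s within S) \<longleftrightarrow>
      ((\<lambda>\<sigma>. norm ((f \<sigma> - f s) /\<^sub>R (\<sigma> - s) - v)) \<longlongrightarrow> 0) (at s within S)"
    by (intro tendsto_cong) (auto simp: eventually_at_filter)
  then show ?thesis
    by (simp only: has_vector_derivative_def has_derivative_within tendsto_norm_zero_iff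
        bounded_linear_scaleR_left simp_thms Lim_null[of _ v] divide_inverse mult_1_left diff_diff_add)
qed

text \<open>The difference quotients \<open>q\<close> in the parameter satisfy the linearized equation up to an error
  that is small uniformly in time. By Gronwall's inequality they are uniformly Cauchy, and so their
  limit exists and solves the linearized equation: no existence theorem for linear equations is
  needed.\<close>

theorem solution_differentiable_in_parameter:
  fixes H :: "'a::euclidean_space \<Rightarrow> 'a" and z :: "real \<Rightarrow> real \<Rightarrow> 'a"
  assumes H: "\<And>a. (H has_derivative blinfun_apply (H' a)) (at a)"
    and H': "continuous_on UNIV H'"
    and z: "\<And>\<sigma> t. \<sigma> \<in> S \<Longrightarrow> t \<in> {0..T} \<Longrightarrow>
      ((\<lambda>\<tau>. z \<tau> \<sigma>) has_vector_derivative H (z t \<sigma>)) (at t within {0..T})"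
    and c: "(z 0 has_vector_derivative c) (at s within S)"
    and s: "s \<in> S" "s islimpt S" and T: "T \<ge> 0"
  obtains v where "v 0 = c"
    "\<And>t. t \<in> {0..T} \<Longrightarrow> (z t has_vector_derivative v t) (at s within S)"
    "\<And>t. t \<in> {0..T} \<Longrightarrow> (v has_vector_derivative H' (z t s) (v t)) (at t within {0..T})"
proof -
  define A where "A = (\<lambda>t. blinfun_apply (H' (z t s)))"
  define q where "q = (\<lambda>\<sigma> t. (z t \<sigma> - z t s) /\<^sub>R (\<sigma> - s))"
  define q' where "q' = (\<lambda>\<sigma> t. (H (z t \<sigma>) - H (z t s)) /\<^sub>R (\<sigma> - s))"
  have q: "(q \<sigma> has_vector_derivative q' \<sigma> t) (at t within {0..T})"
    if "\<sigma> \<in> S" "t \<in> {0..T}" for \<sigma> t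
    unfolding q_def q'_def
    using z[OF that] z[OF s(1) that(2)] by (auto intro!: derivative_eq_intros)
  have q0: "((\<lambda>\<sigma>. q \<sigma> 0) \<longlongrightarrow> c) (at s within S)"
    using c by (simp add: has_vector_derivative_iff_tendsto q_def)
  have linear_A: "bounded_linear (A t)" for t
    unfolding A_def by (rule blinfun.bounded_linear_right)

  define K where "K = (\<lambda>t. z t s) ` {0..T}"
  have K: "compact K" unfolding K_def
    using has_vector_derivative_continuous[OF z[OF s(1)]]
    by (intro compact_continuous_image) (auto simp: continuous_on_eq_continuous_within)
  have "bounded (H' ` K)"
    by (intro compact_imp_bounded compact_continuous_image continuous_on_subset[OF H'] K) simp
  then obtain L where L: "\<And>a. a \<in> K \<Longrightarrow> norm (H' a) \<le> L" "L > 0"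
    unfolding bounded_pos by blast
  have A_le: "norm (A t w) \<le> L * norm w" if "t \<in> {0..T}" for t w
    unfolding A_def using L(1)[of "z t s"] that
    by (intro order_trans[OF norm_blinfun] mult_right_mono) (auto simp: K_def)

  \<comment> \<open>\<open>E\<close> is the growth factor of \<open>gronwall_tube\<close> for the
    Lipschitz constant \<open>L + 1\<close>; \<open>norm c + 1\<close> bounds the initial quotients
    \<open>q \<sigma> 0\<close> for \<open>\<sigma>\<close> near \<open>s\<close>.\<close>
  define E where "E = exp ((L + 1 + 1) * T)"
  define B where "B = (norm c + 1) * E"
  have "E > 0" by (simp add: E_def)
  then have "B > 0" unfolding B_def by (intro mult_pos_pos add_nonneg_pos) auto
  have near: "\<forall>\<^sub>F \<sigma> in at s within S. \<sigma> \<in> S \<and> \<sigma> \<noteq> s"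
    by (simp add: eventually_at_filter)
  have tube: "\<forall>\<^sub>F \<sigma> in at s within S. \<forall>t\<in>{0..T}. norm (z t \<sigma> - z t s) \<le> B * \<bar>\<sigma> - s\<bar>"
  proof -
    \<comment> \<open>Linearizing with tolerance 1 yields the Lipschitz constant
      \<open>L + 1\<close> within distance \<open>\<delta>\<close> of the reference
      trajectory.\<close>
    obtain \<delta> where \<delta>: "\<delta> > 0" "\<And>a b. a \<in> K \<Longrightarrow> norm (b - a) < \<delta> \<Longrightarrow>
        norm (H b - H a - H' a (b - a)) \<le> 1 * norm (b - a)"
      using uniform_linearization_on_compact[OF H H' K zero_less_one] by blast
    have "\<forall>\<^sub>F \<sigma> in at s within S. norm (q \<sigma> 0) < norm c + 1"
      by (rule order_tendstoD(2)[OF tendsto_norm[OF q0]]) simp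
    moreover have "(z 0 \<longlongrightarrow> z 0 s) (at s within S)"
      using has_vector_derivative_continuous[OF c] by (simp add: continuous_within)
    then have "\<forall>\<^sub>F \<sigma> in at s within S. dist (z 0 \<sigma>) (z 0 s) < \<delta> / E"
      using \<delta>(1) \<open>E > 0\<close> by (intro tendstoD) auto
    ultimately show ?thesis
      using near
    proof eventually_elim
      case (elim \<sigma>)
      define p where "p = (\<lambda>t. z t \<sigma> - z t s)"
      show ?case
      proof
        fix t assume t: "t \<in> {0..T}"
        have "norm (p t) \<le> norm (p 0) * exp ((L + 1 + 1) * T)"
        proof (rule gronwall_tube[OF _ _ _ _ t])
          show "(p has_vector_derivative H (z r \<sigma>) - H (z r s)) (at r within {0..T})"
            if "r \<in> {0..T}" for r
            unfolding p_def using z[of \<sigma>, OF _ that] z[OF s(1) that] elim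
            by (auto intro!: derivative_eq_intros)
          show "norm (H (z r \<sigma>) - H (z r s)) \<le> (L + 1) * norm (p r)"
            if "r \<in> {0..T}" "norm (p r) < \<delta>" for r
          proof -
            have "norm (H (z r \<sigma>) - H (z r s) - A r (p r)) \<le> norm (p r)"
              using \<delta>(2)[of "z r s" "z r \<sigma>"] that by (auto simp: p_def K_def A_def)
            with A_le[OF that(1), of "p r"] show ?thesis
              using norm_triangle_sub[of "H (z r \<sigma>) - H (z r s)" "A r (p r)"]
              by (simp add: algebra_simps)
          qed
          show "norm (p 0) * exp ((L + 1 + 1) * T) < \<delta>"
            using elim(2) \<open>E > 0\<close> by (simp add: p_def dist_norm E_def field_simps)
        qed (use L in auto)
        also have "norm (p 0) = norm (q \<sigma> 0) * \<bar>\<sigma> - s\<bar>"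
          using elim by (simp add: p_def q_def)
        also have "norm (q \<sigma> 0) * \<bar>\<sigma> - s\<bar> * exp ((L + 1 + 1) * T) \<le> B * \<bar>\<sigma> - s\<bar>"
        proof -
          have "norm (q \<sigma> 0) * E * \<bar>\<sigma> - s\<bar> \<le> B * \<bar>\<sigma> - s\<bar>"
            unfolding B_def using elim(1) \<open>E > 0\<close> by (intro mult_right_mono) auto
          then show ?thesis by (simp add: E_def mult_ac)
        qed
        finally show "norm (z t \<sigma> - z t s) \<le> B * \<bar>\<sigma> - s\<bar>" by (simp add: p_def)
      qed
    qed
  qed

  \<comment> \<open>The quotient starts within \<open>\<epsilon>\<close> of \<open>c\<close> and
    solves the linearized equation with error at most \<open>\<epsilon>\<close> at all
    times.\<close>
  define good where "good = (\<lambda>\<epsilon> \<sigma>. \<sigma> \<in> S \<and> norm (q \<sigma> 0 - c) \<le> \<epsilon> \<and>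
    (\<forall>t\<in>{0..T}. norm (q' \<sigma> t - A t (q \<sigma> t)) \<le> \<epsilon>))"
  have good: "\<forall>\<^sub>F \<sigma> in at s within S. good \<epsilon> \<sigma>" if "\<epsilon> > 0" for \<epsilon>
  proof -
    \<comment> \<open>The tolerance \<open>\<epsilon> / B\<close> cancels the factor
      \<open>B\<close> of the tube bound, so that division by
      \<open>\<bar>\<sigma> - s\<bar>\<close> leaves the error \<open>\<epsilon>\<close>.\<close>
    have "\<epsilon> / B > 0" using that \<open>B > 0\<close> by simp
    then obtain \<delta> where \<delta>: "\<delta> > 0" "\<And>a b. a \<in> K \<Longrightarrow> norm (b - a) < \<delta> \<Longrightarrow>
        norm (H b - H a - H' a (b - a)) \<le> \<epsilon> / B * norm (b - a)"
      using uniform_linearization_on_compact[OF H H' K] by blast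
    have "\<forall>\<^sub>F \<sigma> in at s within S. dist (q \<sigma> 0) c < \<epsilon>"
      by (rule tendstoD[OF q0 that])
    moreover have "\<forall>\<^sub>F \<sigma> in at s within S. dist \<sigma> s < \<delta> / B"
      using \<delta>(1) \<open>B > 0\<close> by (intro tendstoD[OF tendsto_ident_at]) simp
    ultimately show ?thesis
      using near tube
    proof eventually_elim
      case (elim \<sigma>)
      have "norm (q' \<sigma> t - A t (q \<sigma> t)) \<le> \<epsilon>" if t: "t \<in> {0..T}" for t
      proof -
        have z_le: "norm (z t \<sigma> - z t s) \<le> B * \<bar>\<sigma> - s\<bar>"
          using elim t by blast
        also have "\<dots> < \<delta>"
          using elim \<open>B > 0\<close> by (simp add: dist_real_def field_simps)
        finally have "norm (H (z t \<sigma>) - H (z t s) - A t (z t \<sigma> - z t s)) \<le> \<epsilon> / B * norm (z t \<sigma> - z t s)"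
          unfolding A_def using t by (intro \<delta>(2)) (auto simp: K_def)
        also have "\<dots> \<le> \<epsilon> / B * (B * \<bar>\<sigma> - s\<bar>)"
          by (rule mult_left_mono[OF z_le]) (use \<open>\<epsilon> / B > 0\<close> in simp)
        also have "\<dots> = \<epsilon> * \<bar>\<sigma> - s\<bar>"
          using \<open>B > 0\<close> by simp
        finally have le: "norm (H (z t \<sigma>) - H (z t s) - A t (z t \<sigma> - z t s)) \<le> \<epsilon> * \<bar>\<sigma> - s\<bar>" .
        have "q' \<sigma> t - A t (q \<sigma> t) = (H (z t \<sigma>) - H (z t s) - A t (z t \<sigma> - z t s)) /\<^sub>R (\<sigma> - s)"
          unfolding q'_def q_def linear_simps(5)[OF linear_A] by (simp add: scaleR_diff_right)
        then have "norm (q' \<sigma> t - A t (q \<sigma> t)) =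
            norm (H (z t \<sigma>) - H (z t s) - A t (z t \<sigma> - z t s)) / \<bar>\<sigma> - s\<bar>"
          by (simp add: divide_inverse_commute)
        with le elim show ?thesis by (simp add: pos_divide_le_eq)
      qed
      with elim show ?case by (auto simp: good_def dist_norm)
    qed
  qed

  \<comment> \<open>Two good quotients differ by at most \<open>2 * \<epsilon>\<close> initially and
    by at most \<open>2 * \<epsilon>\<close> in their equation errors; \<open>G\<close> is the
    factor that \<open>gronwall_norm\<close> then produces up to time \<open>T\<close>.\<close>
  define G where "G = sqrt ((1 + T) * exp ((2 * L + 1) * T))"
  have "G > 0" using T by (simp add: G_def)
  have pair: "norm (q \<sigma> t - q \<rho> t) \<le> 2 * \<epsilon> * G"
    if \<sigma>: "good \<epsilon> \<sigma>" and \<rho>: "good \<epsilon> \<rho>" and t: "t \<in> {0..T}" for \<epsilon> \<sigma> \<rho> t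
  proof -
    have "\<epsilon> \<ge> 0" using \<sigma> norm_ge_zero order_trans unfolding good_def by blast
    have "(norm (q \<sigma> t - q \<rho> t))\<^sup>2 \<le>
        ((norm (q \<sigma> 0 - q \<rho> 0))\<^sup>2 + (2 * \<epsilon>)\<^sup>2 * t) * exp ((2 * L + 1) * t)"
    proof (rule gronwall_norm[where p = "\<lambda>t. q \<sigma> t - q \<rho> t" and p' = "\<lambda>t. q' \<sigma> t - q' \<rho> t", OF _ _ _ t])
      fix r assume r: "r \<in> {0..T}"
      show "((\<lambda>t. q \<sigma> t - q \<rho> t) has_vector_derivative q' \<sigma> r - q' \<rho> r) (at r within {0..T})"
        using \<sigma> \<rho> r by (intro has_vector_derivative_diff q) (auto simp: good_def)
      have "norm ((q' \<sigma> r - A r (q \<sigma> r)) - (q' \<rho> r - A r (q \<rho> r))) \<le> \<epsilon> + \<epsilon>"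
        by (rule order_trans[OF norm_triangle_ineq4 add_mono]) (use \<sigma> \<rho> r in \<open>auto simp: good_def\<close>)
      moreover have eq: "q' \<sigma> r - q' \<rho> r =
          ((q' \<sigma> r - A r (q \<sigma> r)) - (q' \<rho> r - A r (q \<rho> r))) + A r (q \<sigma> r - q \<rho> r)"
        by (simp add: linear_simps(2)[OF linear_A])
      moreover note A_le[OF r, of "q \<sigma> r - q \<rho> r"]
      ultimately show "norm (q' \<sigma> r - q' \<rho> r) \<le> L * norm (q \<sigma> r - q \<rho> r) + 2 * \<epsilon>"
        unfolding eq by (intro norm_triangle_le) linarith
    qed (use L in simp)
    also have "\<dots> \<le> ((2 * \<epsilon>)\<^sup>2 + (2 * \<epsilon>)\<^sup>2 * T) * exp ((2 * L + 1) * T)"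
    proof (intro mult_mono add_mono mult_left_mono)
      have "norm ((q \<sigma> 0 - c) - (q \<rho> 0 - c)) \<le> \<epsilon> + \<epsilon>"
        by (rule order_trans[OF norm_triangle_ineq4 add_mono]) (use \<sigma> \<rho> in \<open>auto simp: good_def\<close>)
      then show "(norm (q \<sigma> 0 - q \<rho> 0))\<^sup>2 \<le> (2 * \<epsilon>)\<^sup>2"
        by (intro power_mono) auto
      show "exp ((2 * L + 1) * t) \<le> exp ((2 * L + 1) * T)"
        using t L by (simp add: mult_left_mono)
    qed (use t in auto)
    also have "\<dots> = (2 * \<epsilon> * G)\<^sup>2"
      using T by (simp add: G_def power_mult_distrib algebra_simps)
    finally show ?thesis
      by (rule power2_le_imp_le) (use \<open>\<epsilon> \<ge> 0\<close> \<open>G > 0\<close> in simp)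
  qed

  \<comment> \<open>A sequence serves to construct the limit \<open>v\<close> by completeness;
    \<open>q_v\<close> below extends the convergence to all parameters tending to
    \<open>s\<close>.\<close>
  obtain \<sigma> where \<sigma>: "\<And>n. \<sigma> n \<in> S - {s}" "\<sigma> \<longlonglongrightarrow> s"
    using s(2) unfolding islimpt_sequential by blast
  then have \<sigma>_lim: "filterlim \<sigma> (at s within S) sequentially"
    by (simp add: filterlim_at)
  have good_seq: "\<forall>\<^sub>F n in sequentially. good \<epsilon> (\<sigma> n)" if "\<epsilon> > 0" for \<epsilon>
    using good[OF that] \<sigma>_lim by (rule eventually_compose_filterlim)
  define v where "v = (\<lambda>t. lim (\<lambda>n. q (\<sigma> n) t))"
  have v: "(\<lambda>n. q (\<sigma> n) t) \<longlonglongrightarrow> v t" if t: "t \<in> {0..T}" for t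
  proof -
    have "Cauchy (\<lambda>n. q (\<sigma> n) t)"
    proof (rule CauchyI)
      fix e :: real assume "e > 0"
      then have "e / (4 * G) > 0" using \<open>G > 0\<close> by simp
      from good_seq[OF this] obtain N where N: "\<And>n. n \<ge> N \<Longrightarrow> good (e / (4 * G)) (\<sigma> n)"
        unfolding eventually_sequentially by blast
      have "2 * (e / (4 * G)) * G < e" using \<open>e > 0\<close> \<open>G > 0\<close> by (simp add: field_simps)
      then show "\<exists>N. \<forall>m\<ge>N. \<forall>n\<ge>N. norm (q (\<sigma> m) t - q (\<sigma> n) t) < e"
        using pair[OF N N t] by (meson order_le_less_trans)
    qed
    then show ?thesis
      unfolding v_def by (simp add: Cauchy_convergent_iff convergent_LIMSEQ_iff)
  qed
  have q_v: "norm (q \<rho> t - v t) \<le> 2 * \<epsilon> * G" if "good \<epsilon> \<rho>" "t \<in> {0..T}" "\<epsilon> > 0" for \<epsilon> \<rho> t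
  proof (rule tendsto_upperbound)
    show "(\<lambda>n. norm (q \<rho> t - q (\<sigma> n) t)) \<longlonglongrightarrow> norm (q \<rho> t - v t)"
      by (intro tendsto_intros v that)
    show "\<forall>\<^sub>F n in sequentially. norm (q \<rho> t - q (\<sigma> n) t) \<le> 2 * \<epsilon> * G"
      using good_seq[OF \<open>\<epsilon> > 0\<close>] by eventually_elim (use pair that in blast)
  qed simp

  show thesis
  proof
    show "v 0 = c"
    proof (rule LIMSEQ_unique)
      show "(\<lambda>n. q (\<sigma> n) 0) \<longlonglongrightarrow> v 0" using T by (intro v) simp
      show "(\<lambda>n. q (\<sigma> n) 0) \<longlonglongrightarrow> c" by (rule filterlim_compose[OF q0 \<sigma>_lim])
    qed
  next
    fix t assume t: "t \<in> {0..T}"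
    have "((\<lambda>\<rho>. q \<rho> t) \<longlongrightarrow> v t) (at s within S)"
    proof (rule tendstoI)
      fix e :: real assume "e > 0"
      then have "e / (4 * G) > 0" using \<open>G > 0\<close> by simp
      from good[OF this] show "\<forall>\<^sub>F \<rho> in at s within S. dist (q \<rho> t) (v t) < e"
      proof eventually_elim
        case (elim \<rho>)
        have "2 * (e / (4 * G)) * G < e" using \<open>e > 0\<close> \<open>G > 0\<close> by (simp add: field_simps)
        then show ?case
          using q_v[OF elim t \<open>e / (4 * G) > 0\<close>] by (simp add: dist_norm)
      qed
    qed
    then show "(z t has_vector_derivative v t) (at s within S)"
      by (simp add: has_vector_derivative_iff_tendsto q_def)
  next
    \<comment> \<open>Differentiation passes to the limit because the derivatives \<open>q'\<close>
      converge uniformly in time to \<open>A t (v t)\<close>.\<close>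
    have "\<exists>g. \<forall>t\<in>{0..T}. (\<lambda>n. q (\<sigma> n) t) \<longlonglongrightarrow> g t \<and>
        (g has_derivative (\<lambda>h. h *\<^sub>R A t (v t))) (at t within {0..T})"
    proof (rule has_derivative_sequence)
      show "(q (\<sigma> n) has_derivative (\<lambda>h. h *\<^sub>R q' (\<sigma> n) t)) (at t within {0..T})"
        if "t \<in> {0..T}" for n t
        using q[of "\<sigma> n" t] \<sigma>(1)[of n] that by (simp add: has_vector_derivative_def)
      show "0 \<in> {0..T}" using T by simp
      then show "(\<lambda>n. q (\<sigma> n) 0) \<longlonglongrightarrow> v 0" by (rule v)
      fix e :: real assume "e > 0"
      \<comment> \<open>Chosen so that the equation error \<open>\<epsilon>\<close> plus the effect
        \<open>L * (2 * \<epsilon> * G)\<close> of replacing \<open>q\<close> by \<open>v\<close>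
        inside \<open>A\<close> is exactly \<open>e\<close>.\<close>
      define \<epsilon> where "\<epsilon> = e / (1 + L * (2 * G))"
      have "1 + L * (2 * G) > 0"
        using L(2) \<open>G > 0\<close> by (intro add_pos_pos) auto
      moreover have "\<epsilon> + L * (2 * \<epsilon> * G) = \<epsilon> * (1 + L * (2 * G))"
        by (simp add: algebra_simps)
      ultimately have \<epsilon>: "\<epsilon> > 0" "\<epsilon> + L * (2 * \<epsilon> * G) = e"
        unfolding \<epsilon>_def using \<open>e > 0\<close> by simp_all
      from good_seq[OF \<epsilon>(1)]
      show "\<forall>\<^sub>F n in sequentially. \<forall>t\<in>{0..T}. \<forall>h.
          norm (h *\<^sub>R q' (\<sigma> n) t - h *\<^sub>R A t (v t)) \<le> e * norm h"
      proof eventually_elim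
        case (elim n)
        have "norm (q' (\<sigma> n) t - A t (v t)) \<le> e" if t: "t \<in> {0..T}" for t
        proof -
          have "norm (q' (\<sigma> n) t - A t (q (\<sigma> n) t)) \<le> \<epsilon>"
            using elim t by (simp add: good_def)
          moreover have "norm (A t (q (\<sigma> n) t - v t)) \<le> L * (2 * \<epsilon> * G)"
            using q_v[OF elim t \<epsilon>(1)] L(2) by (intro order_trans[OF A_le[OF t]] mult_left_mono) auto
          ultimately show ?thesis
            using norm_triangle_ineq[of "q' (\<sigma> n) t - A t (q (\<sigma> n) t)" "A t (q (\<sigma> n) t - v t)"] \<epsilon>(2)
            by (simp add: linear_simps(2)[OF linear_A])
        qed
        then show ?case
          by (auto simp: mult.commute[of e] simp flip: scaleR_diff_right intro!: mult_left_mono)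
      qed
    qed simp
    then obtain g where g: "\<And>t. t \<in> {0..T} \<Longrightarrow> (\<lambda>n. q (\<sigma> n) t) \<longlonglongrightarrow> g t"
      "\<And>t. t \<in> {0..T} \<Longrightarrow> (g has_vector_derivative A t (v t)) (at t within {0..T})"
      unfolding has_vector_derivative_def by blast
    fix t assume t: "t \<in> {0..T}"
    \<comment> \<open>The limit \<open>g\<close> equals \<open>v\<close> on \<open>{0..T}\<close> by
      uniqueness of limits.\<close>
    show "(v has_vector_derivative H' (z t s) (v t)) (at t within {0..T})"
      using has_vector_derivative_transform[OF t LIMSEQ_unique[OF v g(1)] g(2)[OF t]] by (simp add: A_def)
  qed
qed

text \<open>The parameter is made part of the state, which turns the auxiliary systems into one autonomous
  system on \<open>(x, s)\<close>.\<close>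

lemma aux_solution_differentiable_in_parameter:
  fixes f \<Delta> :: "'a::euclidean_space \<Rightarrow> 'a"
  assumes f: "\<And>z. (f has_derivative blinfun_apply (f' z)) (at z)" and f': "continuous_on UNIV f'"
    and \<Delta>: "\<And>z. (\<Delta> has_derivative blinfun_apply (\<Delta>' z)) (at z)" and \<Delta>': "continuous_on UNIV \<Delta>'"
    and x: "aux_solution f \<Delta> x0 x0' x"
    and s: "s \<in> {0..1}" and T: "T \<ge> 0"
  obtains w where "w 0 = x0' - x0"
    "\<And>t. t \<in> {0..T} \<Longrightarrow> (x t has_vector_derivative w t) (at s within {0..1})"
    "\<And>t. t \<in> {0..T} \<Longrightarrow> (w has_vector_derivative
        f' (x t s) (w t) + s *\<^sub>R \<Delta>' (x t s) (w t) + \<Delta> (x t s)) (at t within {0..T})"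
proof -
  have x_0: "x 0 \<sigma> = (1 - \<sigma>) *\<^sub>R x0 + \<sigma> *\<^sub>R x0'" if "\<sigma> \<in> {0..1}" for \<sigma>
    using x that by (auto simp: aux_solution_def)
  have x_t: "((\<lambda>\<tau>. x \<tau> \<sigma>) has_vector_derivative aux_field f \<Delta> \<sigma> (x t \<sigma>)) (at t within {0..T})"
    if "\<sigma> \<in> {0..1}" "t \<in> {0..T}" for \<sigma> t
    using x that unfolding aux_solution_def
    by (intro has_vector_derivative_within_subset[of _ _ t "{0..}" "{0..T}"]) auto
  define H where "H = (\<lambda>a::'a \<times> real. (aux_field f \<Delta> (snd a) (fst a), 0::real))"
  \<comment> \<open>The derivative of \<open>H\<close>. Its summand
    \<open>snd b *\<^sub>R \<Delta> (fst a)\<close> comes from varying \<open>s\<close> and becomes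
    the inhomogeneity; the second component vanishes since \<open>s\<close> is constant in
    time.\<close>
  define D where "D = (\<lambda>a b::'a \<times> real. (f' (fst a) (fst b) + snd a *\<^sub>R \<Delta>' (fst a) (fst b)
    + snd b *\<^sub>R \<Delta> (fst a), 0::real))"
  have H: "(H has_derivative D a) (at a)" for a
    unfolding H_def D_def aux_field_def
    by (auto intro!: derivative_eq_intros has_derivative_compose[OF _ f] has_derivative_compose[OF _ \<Delta>])
  have D: "blinfun_apply (Blinfun (D a)) = D a" for a
    by (rule bounded_linear_Blinfun_apply) (rule has_derivative_bounded_linear[OF H])
  have cont: "continuous_on UNIV (\<lambda>a. Blinfun (D a))"
  \<comment> \<open>In finite dimension, operator norm continuity follows from continuity of the
    values on a basis.\<close>
  proof (rule continuous_on_blinfun_componentwise)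
    have "continuous_on UNIV \<Delta>"
      using has_derivative_continuous[OF \<Delta>] by (simp add: continuous_on_eq_continuous_within)
    then have "continuous_on UNIV (\<lambda>a::'a \<times> real. \<Delta> (fst a))"
      "continuous_on UNIV (\<lambda>a::'a \<times> real. f' (fst a))" "continuous_on UNIV (\<lambda>a::'a \<times> real. \<Delta>' (fst a))"
      using continuous_on_fst[OF continuous_on_id]
      by (blast intro: continuous_on_compose2[OF _ _ subset_UNIV] f' \<Delta>')+
    then show "continuous_on UNIV (\<lambda>a. blinfun_apply (Blinfun (D a)) i)" for i
      unfolding D unfolding D_def by (intro continuous_intros)
  qed
  obtain v where v0: "v 0 = (x0' - x0, 1)"
    and v: "\<And>t. t \<in> {0..T} \<Longrightarrow> ((\<lambda>\<sigma>. (x t \<sigma>, \<sigma>)) has_vector_derivative v t) (at s within {0..1})"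
    and v': "\<And>t. t \<in> {0..T} \<Longrightarrow>
      (v has_vector_derivative Blinfun (D (x t s, s)) (v t)) (at t within {0..T})"
  proof (rule solution_differentiable_in_parameter
      [where H = H and H' = "\<lambda>a. Blinfun (D a)" and z = "\<lambda>t \<sigma>. (x t \<sigma>, \<sigma>)" and S = "{0..1}"])
    show "(H has_derivative blinfun_apply (Blinfun (D a))) (at a)" for a
      unfolding D by (rule H)
    show "((\<lambda>\<tau>. (x \<tau> \<sigma>, \<sigma>)) has_vector_derivative H (x t \<sigma>, \<sigma>)) (at t within {0..T})"
      if "\<sigma> \<in> {0..1}" "t \<in> {0..T}" for \<sigma> t
      unfolding H_def using x_t[OF that] by (auto intro!: derivative_eq_intros)
    have "((\<lambda>\<sigma>. ((1 - \<sigma>) *\<^sub>R x0 + \<sigma> *\<^sub>R x0', \<sigma>)) has_vector_derivative (x0' - x0, 1)) (at s within {0..1})"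
      by (auto intro!: derivative_eq_intros)
    then show "((\<lambda>\<sigma>. (x 0 \<sigma>, \<sigma>)) has_vector_derivative (x0' - x0, 1)) (at s within {0..1})"
      by (rule has_vector_derivative_transform[OF s, rotated]) (simp add: x_0)
    show "s islimpt {0..1}" using s by (simp add: islimpt_Icc)
  qed (use cont s T in auto)
  \<comment> \<open>The second component of the augmented state is the parameter itself, so its
    sensitivity stays 1 and \<open>\<Delta>\<close> enters with coefficient 1.\<close>
  have snd_v: "snd (v t) = 1" if t: "t \<in> {0..T}" for t
  proof (rule vector_derivative_unique_within)
    show "at s within {0..1} \<noteq> bot"
      using s by (simp add: trivial_limit_within islimpt_Icc)
    show "((\<lambda>\<sigma>. \<sigma>) has_vector_derivative snd (v t)) (at s within {0..1})"
      using bounded_linear.has_vector_derivative[OF bounded_linear_snd v[OF t]] by simp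
    show "((\<lambda>\<sigma>. \<sigma>) has_vector_derivative 1) (at s within {0..1})"
      by (rule has_vector_derivative_id)
  qed
  show thesis
  proof
    show "fst (v 0) = x0' - x0" by (simp add: v0)
    fix t assume t: "t \<in> {0..T}"
    show "(x t has_vector_derivative fst (v t)) (at s within {0..1})"
      using bounded_linear.has_vector_derivative[OF bounded_linear_fst v[OF t]] by simp
    show "((\<lambda>t. fst (v t)) has_vector_derivative
        f' (x t s) (fst (v t)) + s *\<^sub>R \<Delta>' (x t s) (fst (v t)) + \<Delta> (x t s)) (at t within {0..T})"
      using bounded_linear.has_vector_derivative[OF bounded_linear_fst v'[OF t]] snd_v[OF t]
      by (simp add: D) (simp add: D_def)
  qed
qed

section \<open>Contraction of the weighted output length\<close>

lemma bounded_bilinear_matrix_vector_mult: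
  "bounded_bilinear ((*v) :: real ^ 'n ^ 'm \<Rightarrow> real ^ 'n \<Rightarrow> real ^ 'm)"
  unfolding bilinear_conv_bounded_bilinear[symmetric]
  by (auto simp: bilinear_def linear_iff matrix_vector_mult_add_rdistrib matrix_vector_right_distrib
      matrix_vector_mult_scaleR scaleR_matrix_vector_assoc)

lemma inner_vector_matrix_mult:
  fixes A :: "real ^ 'n ^ 'm"
  shows "u \<bullet> (v v* A) = (A *v u) \<bullet> v"
  by (metis dot_lmul_matrix inner_commute)

text \<open>A non-integrable function has integral 0. This is why integrability of the length density is only
  needed at time 0, where it is continuous in \<open>s\<close>.\<close>

lemma integral_mono_upper_integrable:
  fixes \<phi> \<psi> :: "'a::euclidean_space \<Rightarrow> real"
  assumes "\<psi> integrable_on S" "\<And>s. s \<in> S \<Longrightarrow> \<phi> s \<le> \<psi> s" "\<And>s. s \<in> S \<Longrightarrow> 0 \<le> \<psi> s"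
  shows "integral S \<phi> \<le> integral S \<psi>"
proof (cases "\<phi> integrable_on S")
  case True
  then show ?thesis using assms by (intro integral_le)
next
  case False
  then show ?thesis using assms by (simp add: not_integrable_integral integral_nonneg)
qed

lemma weighted_norm_nonneg: "pos_def W \<Longrightarrow> 0 \<le> weighted_norm W u"
  by (cases "u = 0") (auto simp: weighted_norm_def pos_def_def less_imp_le)

theorem corollary2:
  fixes f g \<Delta> :: "real ^ 'n \<Rightarrow> real ^ 'n"
    and C :: "real ^ 'n ^ 'p"
    and x0 x0' :: "real ^ 'n"
    and M :: "real ^ 'n \<Rightarrow> real ^ 'p ^ 'p"
    and M\<^sub>C :: "real ^ 'n \<Rightarrow> real ^ 'n ^ 'n"
    and x :: "real \<Rightarrow> real \<Rightarrow> real ^ 'n"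
    and y :: "real \<Rightarrow> real \<Rightarrow> real ^ 'p"
    and \<mu> :: real
  assumes f: "continuously_differentiable f"
    and g: "continuously_differentiable g"
    and M: "continuously_differentiable M"
    and M_pos_def: "\<And>z. pos_def (M z)"
    and \<Delta>: "\<Delta> = (\<lambda>z. g z - f z)"
    and M\<^sub>C: "M\<^sub>C = (\<lambda>z. transpose C ** M z ** C)"
    and x: "aux_solution f \<Delta> x0 x0' x"
    and y: "y = (\<lambda>t s. C *v x t s)"
    and \<mu>: "\<mu> > 0"
    and contracting: "\<And>s z. s \<in> {0..1} \<Longrightarrow>
      transpose (jacobian f (at z) + s *\<^sub>R jacobian \<Delta> (at z)) ** M\<^sub>C z
        + transpose C ** derivative_along M (aux_field f \<Delta> s) z ** C
        + M\<^sub>C z ** (jacobian f (at z) + s *\<^sub>R jacobian \<Delta> (at z))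
      \<preceq>\<^sub>L (- 2 * \<mu>) *\<^sub>R M\<^sub>C z"
    and C_\<Delta>: "\<And>z. C *v \<Delta> z = 0"
  shows "\<forall>t\<ge>0. output_length M x y t \<le> exp (- \<mu> * t) * output_length M x y 0"
proof (intro allI impI)
  fix T :: real assume T: "T \<ge> 0"
  obtain f' where f': "\<And>z. (f has_derivative blinfun_apply (f' z)) (at z)" "continuous_on UNIV f'"
    using f unfolding continuously_differentiable_def by blast
  obtain g' where g': "\<And>z. (g has_derivative blinfun_apply (g' z)) (at z)" "continuous_on UNIV g'"
    using g unfolding continuously_differentiable_def by blast
  obtain M' where M': "\<And>z. (M has_derivative blinfun_apply (M' z)) (at z)"
    using M unfolding continuously_differentiable_def by blast
  define \<Delta>' where "\<Delta>' = (\<lambda>z. g' z - f' z)"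
  have \<Delta>': "(\<Delta> has_derivative blinfun_apply (\<Delta>' z)) (at z)" "continuous_on UNIV \<Delta>'" for z
    unfolding \<Delta> \<Delta>'_def
    by (auto intro!: derivative_eq_intros f' g' continuous_intros simp: blinfun.diff_left)
  define J where "J = (\<lambda>s z. jacobian f (at z) + s *\<^sub>R jacobian \<Delta> (at z))"
  define dM where "dM = (\<lambda>s z. derivative_along M (aux_field f \<Delta> s) z)"
  have jacobian_eq: "jacobian h (at z) *v u = h' u" if "(h has_derivative h') (at z)"
    for h :: "real ^ 'n \<Rightarrow> real ^ 'n" and h' z u
    using has_derivative_unique[OF that] jacobian_works[of h "at z"] that differentiableI by metis
  have J: "J s z *v u = f' z u + s *\<^sub>R \<Delta>' z u" for s z u
    by (simp add: J_def matrix_vector_mult_add_rdistrib jacobian_eq[OF f'(1)] jacobian_eq[OF \<Delta>'(1)]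
        flip: scaleR_matrix_vector_assoc)
  have dM: "dM s z = M' z (aux_field f \<Delta> s z)" for s z
    by (simp add: dM_def derivative_along_def flip: frechet_derivative_at[OF M'])
  \<comment> \<open>The contraction inequality tested on \<open>u\<close>. Since
    \<open>M\<^sub>C z\<close> is \<open>transpose C ** M z ** C\<close>, moving the transposes
    across the inner product leaves only \<open>C *v u\<close> and
    \<open>C *v (J s z *v u)\<close>.\<close>
  have lyapunov: "(C *v (J s z *v u)) \<bullet> (M z *v (C *v u)) + (C *v u) \<bullet> (dM s z *v (C *v u))
      + (C *v u) \<bullet> (M z *v (C *v (J s z *v u))) \<le> - 2 * \<mu> * ((C *v u) \<bullet> (M z *v (C *v u)))"
    if "s \<in> {0..1}" for s z u
  proof -
    have "u \<bullet> (((- 2 * \<mu>) *\<^sub>R M\<^sub>C z - (transpose (J s z) ** M\<^sub>C z + transpose C ** dM s z ** C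
        + M\<^sub>C z ** J s z)) *v u) \<ge> 0"
      using contracting[OF that, of z] by (simp add: loewner_le_def pos_semidef_def J_def dM_def)
    then show ?thesis
      unfolding matrix_vector_mult_diff_rdistrib scaleR_matrix_vector_assoc[symmetric]
      by (simp add: M\<^sub>C matrix_vector_mult_add_rdistrib inner_diff_right inner_add_right
          inner_vector_matrix_mult flip: matrix_vector_mul_assoc)
  qed
  let ?dy = "\<lambda>t s. vector_derivative (y t) (at s within {0..1})"
  \<comment> \<open>The initial states are affine in \<open>s\<close>, so the output sensitivity at
    time 0 is the same for all \<open>s\<close>; this gives the continuity of the initial length
    density.\<close>
  have decay: "?dy 0 s = C *v (x0' - x0) \<and>
      weighted_norm (M (x T s)) (?dy T s) \<le> exp (- \<mu> * T) * weighted_norm (M (x 0 s)) (?dy 0 s)"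
    if s: "s \<in> {0..1}" for s
  proof -
    obtain w where w0: "w 0 = x0' - x0"
      and w: "\<And>t. t \<in> {0..T} \<Longrightarrow> (x t has_vector_derivative w t) (at s within {0..1})"
      and w': "\<And>t. t \<in> {0..T} \<Longrightarrow> (w has_vector_derivative
          f' (x t s) (w t) + s *\<^sub>R \<Delta>' (x t s) (w t) + \<Delta> (x t s)) (at t within {0..T})"
      using aux_solution_differentiable_in_parameter[OF f' \<Delta>' x s T] by metis
    have dy: "?dy t s = C *v w t" if "t \<in> {0..T}" for t
      unfolding y using s
      by (intro vector_derivative_within_closed_interval bounded_linear.has_vector_derivative
          [OF matrix_vector_mul_bounded_linear w[OF that]]) auto
    define Y where "Y = (\<lambda>t. C *v w t)"
    define \<Phi> where "\<Phi> = (\<lambda>t. Y t \<bullet> (M (x t s) *v Y t))"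
    \<comment> \<open>\<open>\<Phi>\<close> is the squared weighted norm of
      \<open>\<partial>\<^sub>s y\<close>. It decays at rate \<open>2 * \<mu>\<close>, which the
      square root below turns into \<open>\<mu>\<close>.\<close>
    have "\<Phi> T \<le> (\<Phi> 0 + 0 * T) * exp (- 2 * \<mu> * T)"
    proof (rule gronwall)
      fix t assume t: "t \<in> {0..T}"
      let ?Y' = "C *v (J s (x t s) *v w t)"
      \<comment> \<open>Here \<open>C_\<Delta>\<close> enters: applying \<open>C\<close> removes the
        inhomogeneity \<open>\<Delta> (x t s)\<close> from the equation for
        \<open>w\<close>.\<close>
      have Y: "(Y has_vector_derivative ?Y') (at t within {0..T})"
        using bounded_linear.has_vector_derivative[OF matrix_vector_mul_bounded_linear w'[OF t], of C]
        by (simp add: Y_def J matrix_vector_right_distrib C_\<Delta>)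
      have "((\<lambda>t. x t s) has_vector_derivative aux_field f \<Delta> s (x t s)) (at t within {0..T})"
        using x s t unfolding aux_solution_def
        by (intro has_vector_derivative_within_subset[of _ _ t "{0..}" "{0..T}"]) auto
      then have "((\<lambda>t. M (x t s)) has_vector_derivative dM s (x t s)) (at t within {0..T})"
        unfolding dM has_vector_derivative_def
        using has_derivative_compose[OF _ M'] by (fastforce simp: blinfun.scaleR_right)
      note MY = bounded_bilinear.has_vector_derivative[OF bounded_bilinear_matrix_vector_mult this Y]
      show "(\<Phi> has_real_derivative Y t \<bullet> (M (x t s) *v ?Y' + dM s (x t s) *v Y t)
          + ?Y' \<bullet> (M (x t s) *v Y t)) (at t within {0..T})"
        unfolding \<Phi>_def has_real_derivative_iff_has_vector_derivative
        by (rule bounded_bilinear.has_vector_derivative[OF bounded_bilinear_inner Y MY])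
      \<comment> \<open>The product rule gives exactly the three terms of \<open>lyapunov\<close>,
        with \<open>dM\<close> as the derivative of the weight along the trajectory.\<close>
      show "Y t \<bullet> (M (x t s) *v ?Y' + dM s (x t s) *v Y t) + ?Y' \<bullet> (M (x t s) *v Y t)
          \<le> - 2 * \<mu> * \<Phi> t + 0 * exp (- 2 * \<mu> * t)"
        using lyapunov[OF s, of "x t s" "w t"] by (simp add: \<Phi>_def Y_def inner_add_right)
    qed (use T in simp)
    also have "\<dots> = \<Phi> 0 * (exp (- \<mu> * T))\<^sup>2"
      by (simp flip: exp_double)
    finally have "sqrt (\<Phi> T) \<le> exp (- \<mu> * T) * sqrt (\<Phi> 0)"
      using real_sqrt_le_mono by (fastforce simp: real_sqrt_mult mult.commute)
    then show ?thesis
      using T by (simp add: dy w0 weighted_norm_def \<Phi>_def Y_def)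
  qed
  have "(\<lambda>s. weighted_norm (M (x 0 s)) (?dy 0 s)) integrable_on {0..1}"
  proof (rule integrable_continuous_interval)
    have "continuous_on UNIV M"
      using has_derivative_continuous[OF M'] by (simp add: continuous_on_eq_continuous_within)
    then have "continuous_on {0..1} (\<lambda>s. M ((1 - s) *\<^sub>R x0 + s *\<^sub>R x0'))"
      by (rule continuous_on_compose2) (auto intro!: continuous_intros)
    then have "continuous_on {0..1}
        (\<lambda>s. weighted_norm (M ((1 - s) *\<^sub>R x0 + s *\<^sub>R x0')) (C *v (x0' - x0)))"
      unfolding weighted_norm_def
      by (intro continuous_on_real_sqrt continuous_on_inner continuous_on_const
          bounded_bilinear.continuous_on[OF bounded_bilinear_matrix_vector_mult])
    then show "continuous_on {0..1} (\<lambda>s. weighted_norm (M (x 0 s)) (?dy 0 s))"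
      by (rule continuous_on_eq) (use x conjunct1[OF decay] in \<open>auto simp: aux_solution_def\<close>)
  qed
  then have "integral {0..1} (\<lambda>s. weighted_norm (M (x T s)) (?dy T s))
      \<le> integral {0..1} (\<lambda>s. exp (- \<mu> * T) * weighted_norm (M (x 0 s)) (?dy 0 s))"
    using conjunct2[OF decay] weighted_norm_nonneg[OF M_pos_def]
    by (intro integral_mono_upper_integrable integrable_on_cmult_left) auto
  then show "output_length M x y T \<le> exp (- \<mu> * T) * output_length M x y 0"
    by (simp add: output_length_def)
qed

end
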